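(* Let $\mathcal{I}$ and $\mathcal{J}$ be filtrations of a Noetherian ring $R$ and let $\alpha\in\mathbb{R}_{>0}$. Then $\mathcal{I}$ is projectively equivalent to $\mathcal{J}$ with $\overline{\nu}_{\mathcal{I}} = \alpha\, \overline{\nu}_{\mathcal{J}}$ if and only if $\mathcal{K}(\mathcal{I}^{(\alpha)}) = \mathcal{K}(\mathcal{J})$.
   Context: Rings are commutative with identity, and $\mathbb{N}$ denotes the nonnegative integers. A filtration of a ring $R$ is a family $\mathcal{I} = \{I_m\}_{m\in\mathbb{N}}$ of ideals of $R$ with $I_0 = R$, $I_n \supseteq I_{n+1}$ and $I_n I_m \subseteq I_{n+m}$ for all $m,n \in \mathbb{N}$. The order of $\mathcal{I}$ is $\nu_{\mathcal{I}}(f) = \sup\{m \mid f \in I_m\} \in \mathbb{N}\cup\{\infty\}$ for $f \in R$. The asymptotic Samuel function of $\mathcal{I}$ is $\overline{\nu}_{\mathcal{I}} : R \to \mathbb{R}_{\ge 0}\cup\{\infty\}$, $\overline{\nu}_{\mathcal{I}}(x) = \lim_{n\to\infty} \nu_{\mathcal{I}}(x^n)/n$ (this limit always exists in $\mathbb{R}_{\ge 0}\cup\{\infty\}$). Filtrations $\mathcal{I}$ and $\mathcal{J}$ are projectively equivalent if there exists $\alpha \in \mathbb{R}_{>0}$ such that $\overline{\nu}_{\mathcal{I}} = \alpha\, \overline{\nu}_{\mathcal{J}}$ (with $\alpha\cdot\infty=\infty$). For $\alpha \in \mathbb{R}_{>0}$, the twist of $\mathcal{I}$ by $\alpha$ is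 the filtration $\mathcal{I}^{(\alpha)} = \{I_{\lceil \alpha m\rceil}\}_{m\in\mathbb{N}}$. For any filtration $\mathcal{L}$ of $R$, $\mathcal{K}(\mathcal{L}) = \{K(\mathcal{L})_m\}_{m\in\mathbb{N}}$ is the filtration with $K(\mathcal{L})_m = \{f\in R\mid \overline{\nu}_{\mathcal{L}}(f)\ge m\}$. *)

theory Defs
  imports
    "HOL-Algebra.Ideal_Product"
    "HOL-Algebra.Ring_Divisibility"
    "HOL-Analysis.Analysis"
begin

definition filtration :: "('a, 'b) ring_scheme \<Rightarrow> (nat \<Rightarrow> 'a set) \<Rightarrow> bool" where
  "filtration R I \<longleftrightarrow>
     (\<forall>m. ideal (I m) R) \<and>
     I 0 = carrier R \<and>
     (\<forall>n. I (Suc n) \<subseteq> I n) \<and>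
     (\<forall>m n. ideal_prod R (I n) (I m) \<subseteq> I (n + m))"

text \<open>The supremum is taken in \<open>enat\<close>, so it is \<open>\<infinity>\<close> if \<open>f\<close> lies in infinitely many \<open>I m\<close>.\<close>

definition filt_order :: "(nat \<Rightarrow> 'a set) \<Rightarrow> 'a \<Rightarrow> enat" where
  "filt_order I f = (SUP m\<in>{m. f \<in> I m}. enat m)"

text \<open>The limit is taken in \<open>ennreal\<close>, that is, in the nonnegative reals with \<open>\<infinity>\<close>. For elements
  of the carrier and a filtration \<open>I\<close> it exists. The term at \<open>n = 0\<close> plays no role.\<close>

definition asymptotic_samuel ::
    "('a, 'b) ring_scheme \<Rightarrow> (nat \<Rightarrow> 'a set) \<Rightarrow> 'a \<Rightarrow> ennreal" where
  "asymptotic_samuel R I x =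
     lim (\<lambda>n. ennreal_of_enat (filt_order I (x [^]\<^bsub>R\<^esub> n)) / of_nat n)"

definition projectively_equivalent ::
    "('a, 'b) ring_scheme \<Rightarrow> (nat \<Rightarrow> 'a set) \<Rightarrow> (nat \<Rightarrow> 'a set) \<Rightarrow> bool" where
  "projectively_equivalent R I J \<longleftrightarrow>
     (\<exists>\<alpha>::real. \<alpha> > 0 \<and>
        (\<forall>x\<in>carrier R. asymptotic_samuel R I x = ennreal \<alpha> * asymptotic_samuel R J x))"

definition twist :: "real \<Rightarrow> (nat \<Rightarrow> 'a set) \<Rightarrow> nat \<Rightarrow> 'a set" where
  "twist \<alpha> I m = I (nat \<lceil>\<alpha> * real m\<rceil>)"

definition samuel_filtration ::
    "('a, 'b) ring_scheme \<Rightarrow> (nat \<Rightarrow> 'a set) \<Rightarrow> nat \<Rightarrow> 'a set" where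
  "samuel_filtration R L m = {f \<in> carrier R. asymptotic_samuel R L f \<ge> of_nat m}"

lemma filtration_antimono:
  assumes "filtration R I" "m \<le> n"
  shows "I n \<subseteq> I m"
proof (rule lift_Suc_antimono_le[OF _ assms(2)])
  show "I (Suc k) \<subseteq> I k" for k
    using assms(1) by (simp add: filtration_def)
qed

lemma filtration_twist:
  assumes I: "filtration R I" and \<alpha>: "\<alpha> > 0"
  shows "filtration R (twist \<alpha> I)"
proof -
  have "ideal_prod R (twist \<alpha> I n) (twist \<alpha> I m) \<subseteq> twist \<alpha> I (n + m)" for m n
  proof -
    have "\<lceil>\<alpha> * real (n + m)\<rceil> \<le> \<lceil>\<alpha> * real n\<rceil> + \<lceil>\<alpha> * real m\<rceil>"
      by (simp add: distrib_left ceiling_add_le)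
    moreover have "0 \<le> \<lceil>\<alpha> * real n\<rceil>" "0 \<le> \<lceil>\<alpha> * real m\<rceil>"
      using \<alpha> by (auto intro: order.strict_trans2[of "-1" 0])
    ultimately have "nat \<lceil>\<alpha> * real (n + m)\<rceil> \<le> nat \<lceil>\<alpha> * real n\<rceil> + nat \<lceil>\<alpha> * real m\<rceil>"
      by linarith
    then have "I (nat \<lceil>\<alpha> * real n\<rceil> + nat \<lceil>\<alpha> * real m\<rceil>) \<subseteq> twist \<alpha> I (n + m)"
      unfolding twist_def by (rule filtration_antimono[OF I])
    moreover have "ideal_prod R (twist \<alpha> I n) (twist \<alpha> I m)
        \<subseteq> I (nat \<lceil>\<alpha> * real n\<rceil> + nat \<lceil>\<alpha> * real m\<rceil>)"
      using I by (simp add: twist_def filtration_def)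
    ultimately show ?thesis by (rule subset_trans[rotated])
  qed
  moreover have "twist \<alpha> I (Suc n) \<subseteq> twist \<alpha> I n" for n
    unfolding twist_def using \<alpha>
    by (auto intro!: filtration_antimono[OF I] nat_mono ceiling_mono mult_left_mono simp del: of_nat_Suc)
  ultimately show ?thesis
    using I by (auto simp: filtration_def twist_def)
qed

end

theory Submission
  imports Defs "HOL-Real_Asymp.Real_Asymp"
begin

text \<open>A superadditive sequence \<open>a\<close> has \<open>a n / n \<longlonglongrightarrow> SUP a n / n\<close> (Fekete), so the limit
  defining \<open>\<nu>\<^sub>I\<close>-bar exists, and it is homogeneous: its value at \<open>x ^ n\<close> is \<open>n\<close> times its value
  at \<open>x\<close>. The order of the twist by \<open>\<alpha>\<close> is the integer part of the order of \<open>I\<close> divided by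
  \<open>\<alpha>\<close>, and the rounding error disappears in the limit; hence the claim reduces to \<open>\<alpha> = 1\<close>.
  There, equality of the Samuel filtrations at all powers \<open>x ^ n\<close> says that the two functions
  exceed the same rationals \<open>m / n\<close> at \<open>x\<close>.\<close>

section \<open>Superadditive sequences and Fekete's limit\<close>

lemma superadditive_mult_le:
  fixes a :: "nat \<Rightarrow> ennreal"
  assumes "\<And>m n. a m + a n \<le> a (m + n)"
  shows "of_nat q * a k \<le> a (q * k + r)"
proof (induction q)
  case (Suc q)
  have "of_nat (Suc q) * a k = a k + of_nat q * a k" by (simp add: distrib_right)
  also have "\<dots> \<le> a k + a (q * k + r)" using Suc by (rule add_left_mono)
  also have "\<dots> \<le> a (k + (q * k + r))" by (rule assms)
  finally show ?case by (simp add: add.assoc)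
qed simp

text \<open>Every term is at most the supremum. For the lower bound, fix a good index
  \<open>k\<close> and divide \<open>n\<close> by \<open>k\<close> with remainder: superadditivity
  loses at most the remainder, whose share of \<open>n\<close> tends to 0.\<close>

lemma fekete_ennreal:
  fixes a :: "nat \<Rightarrow> ennreal"
  assumes super: "\<And>m n. a m + a n \<le> a (m + n)"
  shows "(\<lambda>n. a n / of_nat n) \<longlonglongrightarrow> (SUP n\<in>{1..}. a n / of_nat n)"
proof (rule order_tendstoI)
  fix c assume "c < (SUP n\<in>{1..}. a n / of_nat n)"
  then obtain k where k: "k \<ge> 1" "c < a k / of_nat k"
    by (auto simp: less_SUP_iff)
  \<comment> \<open>The intermediate \<open>d\<close> is finite even when \<open>a k\<close> is
    infinite, so the estimates below can be made with the real number \<open>e\<close>.\<close>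
  obtain d where d: "c < d" "d < a k / of_nat k"
    using dense[OF k(2)] by auto
  then obtain e where e: "d = ennreal e" "e \<ge> 0"
    by (cases d) (auto simp: top_unique)
  have ak: "ennreal (real k * e) \<le> a k"
  proof -
    have "d * of_nat k \<le> a k / of_nat k * of_nat k"
      using d by (intro mult_right_mono) auto
    also have "\<dots> = a k"
      using k by (simp add: ennreal_divide_times of_nat_less_top)
    finally show ?thesis using e
      by (simp add: ennreal_mult mult.commute ennreal_of_nat_eq_real_of_nat)
  qed
  have lower: "ennreal ((real n - real k) * e / real n) \<le> a n / of_nat n" if n: "n \<ge> 1" for n
  proof -
    have "real n = real (n div k) * real k + real (n mod k)"
      by (metis div_mult_mod_eq of_nat_add of_nat_mult)
    moreover have "n mod k < k" using k by simp
    ultimately have "(real n - real k) * e \<le> real (n div k) * real k * e"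
      using e by (intro mult_right_mono) auto
    then have "ennreal ((real n - real k) * e) \<le> of_nat (n div k) * ennreal (real k * e)"
      using e by (simp add: ennreal_of_nat_eq_real_of_nat ennreal_mult[symmetric] mult.assoc
          ennreal_leI)
    also have "\<dots> \<le> of_nat (n div k) * a k"
      using ak by (intro mult_left_mono) auto
    also have "\<dots> \<le> a n"
      using superadditive_mult_le[OF super, of "n div k" k "n mod k"] by simp
    finally have "ennreal ((real n - real k) * e) / of_nat n \<le> a n / of_nat n"
      by (rule divide_right_mono_ennreal)
    moreover have "ennreal ((real n - real k) * e / real n)
        \<le> ennreal ((real n - real k) * e) / of_nat n"
    \<comment> \<open>For \<open>n < k\<close> the real factor may be negative;
      \<open>ennreal\<close> then truncates to 0 and the bound is trivial.\<close>
    proof (cases "(real n - real k) * e \<ge> 0")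
      case True
      then show ?thesis
        using n by (simp add: ennreal_of_nat_eq_real_of_nat divide_ennreal)
    next
      case False
      then have "(real n - real k) * e / real n \<le> 0" by (simp add: divide_nonpos_nonneg)
      then show ?thesis by (simp add: ennreal_neg)
    qed
    ultimately show ?thesis by (rule order_trans[rotated])
  qed
  have "(\<lambda>n. (real n - real k) * e / real n) \<longlonglongrightarrow> e"
    by real_asymp
  then have "(\<lambda>n. ennreal ((real n - real k) * e / real n)) \<longlonglongrightarrow> d"
    unfolding e by (rule tendsto_ennrealI)
  then have "\<forall>\<^sub>F n in sequentially. c < ennreal ((real n - real k) * e / real n)"
    using d(1) by (rule order_tendstoD(1))
  then show "\<forall>\<^sub>F n in sequentially. c < a n / of_nat n"
    using eventually_ge_at_top[of 1]
    by eventually_elim (use lower in \<open>auto intro: less_le_trans\<close>)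
next
  fix c assume c: "(SUP n\<in>{1..}. a n / of_nat n) < c"
  show "\<forall>\<^sub>F n in sequentially. a n / of_nat n < c"
    using eventually_ge_at_top[of 1]
    by eventually_elim (auto intro: le_less_trans[OF SUP_upper c])
qed

section \<open>The order of a filtration\<close>

lemma mem_iff_le_filt_order:
  assumes I: "filtration R I" and f: "f \<in> carrier R"
  shows "f \<in> I m \<longleftrightarrow> enat m \<le> filt_order I f"
proof
  show "f \<in> I m \<Longrightarrow> enat m \<le> filt_order I f"
    unfolding filt_order_def by (rule SUP_upper) simp
next
  assume le: "enat m \<le> filt_order I f"
  show "f \<in> I m"
  proof (cases m)
    case 0
    then show ?thesis using I f by (simp add: filtration_def)
  next
    case (Suc k)
    then have "enat k < filt_order I f" using le by (metis Suc_ile_eq)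
    then obtain l where "f \<in> I l" "k < l"
      unfolding filt_order_def by (auto simp: less_SUP_iff)
    then show ?thesis
      using filtration_antimono[OF I, of m l] Suc by auto
  qed
qed

text \<open>Testing at finite levels turns inequalities between orders, possibly infinite, into
  memberships in the ideals.\<close>

lemma enat_leI:
  assumes "\<And>k. enat k \<le> a \<Longrightarrow> enat k \<le> b"
  shows "a \<le> b"
proof (cases a)
  case infinity
  have "b = \<infinity>"
  proof (rule ccontr)
    assume "b \<noteq> \<infinity>"
    then obtain j where "b = enat j" by auto
    then show False using assms[of "Suc j"] infinity by simp
  qed
  then show ?thesis by simp
qed (use assms in auto)

text \<open>The inclusion of \<open>ideal_prod R (I m) (I n)\<close> in \<open>I (m + n)\<close>
  gives this. Applied to powers of one element, it is the superadditivity that Fekete's lemma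
  requires.\<close>

lemma (in ring) filt_order_mult:
  assumes I: "filtration R I" and x: "x \<in> carrier R" and y: "y \<in> carrier R"
  shows "filt_order I x + filt_order I y \<le> filt_order I (x \<otimes> y)"
proof (rule enat_leI)
  fix k assume k: "enat k \<le> filt_order I x + filt_order I y"
  \<comment> \<open>A factor of infinite order supplies the whole level \<open>k\<close> alone, the
    other one contributing level 0.\<close>
  obtain m n where mn: "k \<le> m + n" "enat m \<le> filt_order I x" "enat n \<le> filt_order I y"
  proof (cases "filt_order I x")
    case (enat m)
    show ?thesis
    proof (cases "filt_order I y")
      case (enat n)
      with \<open>filt_order I x = enat m\<close> k show ?thesis by (intro that[of m n]) auto
    next
      case infinity
      then show ?thesis by (intro that[of 0 k]) (auto simp: zero_enat_def[symmetric])
    qed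
  next
    case infinity
    then show ?thesis by (intro that[of k 0]) (auto simp: zero_enat_def[symmetric])
  qed
  have "x \<in> I m" "y \<in> I n"
    using mn mem_iff_le_filt_order[OF I] x y by auto
  then have "x \<otimes> y \<in> ideal_prod R (I m) (I n)"
    by (rule ideal_prod.prod)
  moreover have "ideal_prod R (I m) (I n) \<subseteq> I (m + n)"
    using I by (simp add: filtration_def)
  ultimately have "x \<otimes> y \<in> I k"
    using filtration_antimono[OF I mn(1)] by blast
  then show "enat k \<le> filt_order I (x \<otimes> y)"
    using mem_iff_le_filt_order[OF I] x y by auto
qed

section \<open>Existence and homogeneity of the asymptotic Samuel function\<close>

lemma (in ring) asymptotic_samuel_tendsto:
  assumes I: "filtration R I" and x: "x \<in> carrier R"
  shows "(\<lambda>n. ennreal_of_enat (filt_order I (x [^] n)) / of_nat n)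
           \<longlonglongrightarrow> asymptotic_samuel R I x"
proof -
  have "ennreal_of_enat (filt_order I (x [^] m)) + ennreal_of_enat (filt_order I (x [^] n))
        \<le> ennreal_of_enat (filt_order I (x [^] (m + n)))" for m n :: nat
    using filt_order_mult[OF I, of "x [^] m" "x [^] n"] x
    by (simp add: nat_pow_mult ennreal_of_enat_plus[symmetric] del: ennreal_of_enat_plus)
  from fekete_ennreal[of "\<lambda>n. ennreal_of_enat (filt_order I (x [^] n))", OF this]
  show ?thesis
    unfolding asymptotic_samuel_def by (metis limI)
qed

text \<open>The powers of \<open>x [^] k\<close> are the powers of \<open>x\<close> at multiples of
  \<open>k\<close>, and a subsequence keeps the limit; the factor \<open>k\<close> comes from
  dividing by \<open>n\<close> instead of \<open>k * n\<close>.\<close>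

lemma (in ring) asymptotic_samuel_pow:
  assumes I: "filtration R I" and x: "x \<in> carrier R" and k: "k \<ge> 1"
  shows "asymptotic_samuel R I (x [^] (k::nat)) = of_nat k * asymptotic_samuel R I x"
proof -
  let ?a = "\<lambda>n. ennreal_of_enat (filt_order I (x [^] n))"
  have "strict_mono (\<lambda>n. k * n)" using k by (auto intro: strict_monoI)
  from LIMSEQ_subseq_LIMSEQ[OF asymptotic_samuel_tendsto[OF I x] this]
  have "(\<lambda>n. ?a (k * n) / of_nat (k * n)) \<longlonglongrightarrow> asymptotic_samuel R I x"
    by (simp add: o_def)
  then have "(\<lambda>n. of_nat k * (?a (k * n) / of_nat (k * n)))
      \<longlonglongrightarrow> of_nat k * asymptotic_samuel R I x"
    by (intro ennreal_tendsto_cmult) (auto simp: of_nat_less_top)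
  moreover have "\<forall>\<^sub>F n in sequentially. of_nat k * (?a (k * n) / of_nat (k * n))
      = ennreal_of_enat (filt_order I ((x [^] k) [^] n)) / of_nat n"
    using eventually_ge_at_top[of 1]
  proof eventually_elim
    case (elim n)
    have "of_nat k * (?a (k * n) / of_nat (k * n)) = of_nat k * ?a (k * n) / (of_nat k * of_nat n)"
      by (simp add: ennreal_times_divide)
    also have "\<dots> = ?a (k * n) / of_nat n"
      using k divide_mult_eq[of "of_nat k" "?a (k * n)" "of_nat n"] by (simp add: mult.commute)
    finally show ?case using x by (simp add: nat_pow_pow)
  qed
  ultimately have "(\<lambda>n. ennreal_of_enat (filt_order I ((x [^] k) [^] n)) / of_nat n)
      \<longlonglongrightarrow> of_nat k * asymptotic_samuel R I x"
    by (rule Lim_transform_eventually)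
  moreover have "(\<lambda>n. ennreal_of_enat (filt_order I ((x [^] k) [^] n)) / of_nat n)
      \<longlonglongrightarrow> asymptotic_samuel R I (x [^] k)"
    using x by (intro asymptotic_samuel_tendsto[OF I]) auto
  ultimately show ?thesis by (rule LIMSEQ_unique[symmetric])
qed

section \<open>Orders under a twist\<close>

lemma filt_order_twist_iff:
  assumes I: "filtration R I" and \<alpha>: "\<alpha> > 0" and f: "f \<in> carrier R"
  shows "enat m \<le> filt_order (twist \<alpha> I) f \<longleftrightarrow> enat (nat \<lceil>\<alpha> * real m\<rceil>) \<le> filt_order I f"
  using mem_iff_le_filt_order[OF I f] mem_iff_le_filt_order[OF filtration_twist[OF I \<alpha>] f]
  by (simp add: twist_def)

lemma filt_order_twist_lower:
  assumes I: "filtration R I" and \<alpha>: "\<alpha> > 0" and f: "f \<in> carrier R"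
  shows "ennreal \<alpha> * ennreal_of_enat (filt_order (twist \<alpha> I) f) \<le> ennreal_of_enat (filt_order I f)"
proof (cases "filt_order I f")
  case (enat k)
  have bound: "\<alpha> * real m \<le> real k" if "enat m \<le> filt_order (twist \<alpha> I) f" for m
    using that enat filt_order_twist_iff[OF I \<alpha> f, of m] by (simp; linarith)
  show ?thesis
  proof (cases "filt_order (twist \<alpha> I) f")
    case (enat m)
    then show ?thesis
      using bound[of m] \<open>filt_order I f = enat k\<close> \<alpha>
      by (simp add: ennreal_of_nat_eq_real_of_nat ennreal_mult[symmetric] ennreal_leI)
  next
    case infinity
    \<comment> \<open>An infinite order of the twist would make \<open>bound\<close> hold for all
      \<open>m\<close>, against the Archimedean property.\<close>
    obtain m where "real k / \<alpha> < real m" using reals_Archimedean2 by blast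
    then show ?thesis using bound[of m] infinity \<alpha> by (simp add: field_simps)
  qed
qed simp

text \<open>If the twist has order \<open>m\<close>, then \<open>f\<close> misses its level
  \<open>m + 1\<close>, so the order of \<open>f\<close> is below \<alpha>(m + 1). The error
  \<alpha> does not depend on \<open>f\<close>, so for the powers of an element it vanishes after
  division by the exponent.\<close>

lemma filt_order_twist_upper:
  assumes I: "filtration R I" and \<alpha>: "\<alpha> > 0" and f: "f \<in> carrier R"
  shows "ennreal_of_enat (filt_order I f)
    \<le> ennreal \<alpha> * ennreal_of_enat (filt_order (twist \<alpha> I) f) + ennreal \<alpha>"
proof (cases "filt_order (twist \<alpha> I) f")
  case (enat m)
  have "\<not> enat (Suc m) \<le> filt_order (twist \<alpha> I) f" using enat by simp
  then have "filt_order I f < enat (nat \<lceil>\<alpha> * real (Suc m)\<rceil>)"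
    using filt_order_twist_iff[OF I \<alpha> f, of "Suc m"] by simp
  then obtain k where k: "filt_order I f = enat k" "k < nat \<lceil>\<alpha> * real (Suc m)\<rceil>"
    by (cases "filt_order I f") auto
  then have "real k \<le> \<alpha> * real m + \<alpha>"
    by (simp add: zless_nat_eq_int_zless less_ceiling_iff algebra_simps)
  then show ?thesis
    using \<alpha> k(1) enat
    by (simp add: ennreal_of_nat_eq_real_of_nat ennreal_mult[symmetric] ennreal_plus[symmetric]
        ennreal_leI del: ennreal_plus)
next
  case infinity
  then show ?thesis using \<alpha> by (simp add: ennreal_mult_top)
qed

lemma (in ring) asymptotic_samuel_twist:
  assumes I: "filtration R I" and \<alpha>: "\<alpha> > 0" and x: "x \<in> carrier R"
  shows "asymptotic_samuel R I x = ennreal \<alpha> * asymptotic_samuel R (twist \<alpha> I) x"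
proof -
  let ?t = "\<lambda>n. ennreal_of_enat (filt_order (twist \<alpha> I) (x [^] n)) / of_nat n"
  let ?a = "\<lambda>n. ennreal_of_enat (filt_order I (x [^] n)) / of_nat n"
  have low: "(\<lambda>n. ennreal \<alpha> * ?t n) \<longlonglongrightarrow> ennreal \<alpha> * asymptotic_samuel R (twist \<alpha> I) x"
    by (intro ennreal_tendsto_cmult asymptotic_samuel_tendsto filtration_twist assms) simp
  have "(\<lambda>n. ennreal (\<alpha> / real n)) \<longlonglongrightarrow> ennreal 0"
    by (intro tendsto_ennrealI) real_asymp
  then have up: "(\<lambda>n. ennreal \<alpha> * ?t n + ennreal (\<alpha> / real n))
      \<longlonglongrightarrow> ennreal \<alpha> * asymptotic_samuel R (twist \<alpha> I) x"
    using tendsto_add[OF low] by fastforce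
  have "\<forall>\<^sub>F n in sequentially. ennreal \<alpha> * ?t n \<le> ?a n"
    using filt_order_twist_lower[OF I \<alpha>] x
    by (auto simp: ennreal_times_divide intro!: always_eventually divide_right_mono_ennreal)
  moreover have "\<forall>\<^sub>F n in sequentially. ?a n \<le> ennreal \<alpha> * ?t n + ennreal (\<alpha> / real n)"
    using eventually_ge_at_top[of 1]
  proof eventually_elim
    case (elim n)
    have "?a n \<le> (ennreal \<alpha> * ennreal_of_enat (filt_order (twist \<alpha> I) (x [^] n)) + ennreal \<alpha>)
        / of_nat n"
      using filt_order_twist_upper[OF I \<alpha>, of "x [^] n"] x by (intro divide_right_mono_ennreal) auto
    also have "\<dots> = ennreal \<alpha> * ?t n + ennreal (\<alpha> / real n)"
      using elim \<alpha> by (simp add: add_divide_distrib_ennreal ennreal_times_divide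
          ennreal_of_nat_eq_real_of_nat divide_ennreal)
    finally show ?case .
  qed
  ultimately have "?a \<longlonglongrightarrow> ennreal \<alpha> * asymptotic_samuel R (twist \<alpha> I) x"
    by (rule tendsto_sandwich[OF _ _ low up])
  with asymptotic_samuel_tendsto[OF I x] show ?thesis by (rule LIMSEQ_unique)
qed

text \<open>The rationals m/n separate distinct values. The condition is stated with multiples to
  match the value of the asymptotic Samuel function at an \<open>n\<close>-th power.\<close>

lemma ennreal_le_by_multiples:
  fixes a b :: ennreal
  assumes "\<And>m n. n \<ge> 1 \<Longrightarrow> of_nat m \<le> of_nat n * a \<Longrightarrow> of_nat m \<le> of_nat n * b"
  shows "a \<le> b"
proof (rule ccontr)
  assume "\<not> a \<le> b"
  then have ba: "b < a" by simp
  then obtain r where r: "b = ennreal r" "r \<ge> 0" by (cases b) auto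
  obtain c where c: "b < c" "c < a" using dense[OF ba] by auto
  then obtain s where s: "c = ennreal s" "s \<ge> 0" by (cases c) (auto simp: top_unique)
  have "r < s" using c(1) r s by (simp add: ennreal_less_iff)
  \<comment> \<open>This makes n(s - r) > 1, so rounding \<open>n * s\<close> down to the integer
    \<open>m\<close> still leaves it above \<open>n * r\<close>.\<close>
  then obtain n where n: "1 / (s - r) < real n" using reals_Archimedean2 by blast
  define m where "m = nat \<lfloor>real n * s\<rfloor>"
  have n1: "real n * s > real n * r + 1" using n \<open>r < s\<close> by (simp add: field_simps)
  have "0 < 1 / (s - r)" using \<open>r < s\<close> by simp
  then have "n \<ge> 1" using n by (cases n) auto
  have "real m \<le> real n * s" unfolding m_def using s by simp
  then have "of_nat m \<le> of_nat n * c"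
    using s by (simp add: ennreal_of_nat_eq_real_of_nat ennreal_mult[symmetric] ennreal_leI)
  also have "\<dots> \<le> of_nat n * a" using c by (intro mult_left_mono) auto
  finally have "of_nat m \<le> of_nat n * b" using assms \<open>n \<ge> 1\<close> by blast
  then have "real m \<le> real n * r"
    using r by (simp add: ennreal_of_nat_eq_real_of_nat ennreal_mult[symmetric])
  moreover have "real m > real n * s - 1" unfolding m_def using s by (simp; linarith)
  ultimately show False using n1 by linarith
qed

text \<open>Membership of \<open>x\<close> itself only tests integer thresholds; membership of
  \<open>x [^] n\<close> at level \<open>m\<close> tests the threshold m/n.\<close>

lemma (in ring) asymptotic_samuel_le:
  assumes L: "filtration R L" and J: "filtration R J" and x: "x \<in> carrier R"
    and sub: "\<And>m. samuel_filtration R L m \<subseteq> samuel_filtration R J m"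
  shows "asymptotic_samuel R L x \<le> asymptotic_samuel R J x"
proof (rule ennreal_le_by_multiples)
  fix m n :: nat
  assume n: "n \<ge> 1" and le: "of_nat m \<le> of_nat n * asymptotic_samuel R L x"
  then have "x [^] n \<in> samuel_filtration R L m"
    using asymptotic_samuel_pow[OF L x n] x by (simp add: samuel_filtration_def)
  then have "x [^] n \<in> samuel_filtration R J m" using sub by blast
  then show "of_nat m \<le> of_nat n * asymptotic_samuel R J x"
    using asymptotic_samuel_pow[OF J x n] by (simp add: samuel_filtration_def)
qed

lemma (in ring) samuel_filtration_eq_iff:
  assumes L: "filtration R L" and J: "filtration R J"
  shows "samuel_filtration R L = samuel_filtration R J
    \<longleftrightarrow> (\<forall>x\<in>carrier R. asymptotic_samuel R L x = asymptotic_samuel R J x)"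
proof
  assume "samuel_filtration R L = samuel_filtration R J"
  then show "\<forall>x\<in>carrier R. asymptotic_samuel R L x = asymptotic_samuel R J x"
    using asymptotic_samuel_le[OF L J] asymptotic_samuel_le[OF J L] by (auto intro: antisym)
qed (auto simp: samuel_filtration_def fun_eq_iff)

theorem theorem1p4:
  fixes R :: "('a, 'b) ring_scheme"
    and I J :: "nat \<Rightarrow> 'a set"
    and \<alpha> :: real
  assumes "cring R" and "noetherian_ring R"
    and "filtration R I" and "filtration R J"
    and "\<alpha> > 0"
  shows "(projectively_equivalent R I J \<and>
          (\<forall>x\<in>carrier R. asymptotic_samuel R I x = ennreal \<alpha> * asymptotic_samuel R J x))
         \<longleftrightarrow> samuel_filtration R (twist \<alpha> I) = samuel_filtration R J"
proof -
  interpret cring R by fact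
  \<comment> \<open>The twist formula puts the factor \<alpha> on both sides, where it cancels,
    being positive and finite.\<close>
  have "asymptotic_samuel R I x = ennreal \<alpha> * asymptotic_samuel R J x
      \<longleftrightarrow> asymptotic_samuel R (twist \<alpha> I) x = asymptotic_samuel R J x" if "x \<in> carrier R" for x
    using asymptotic_samuel_twist[OF assms(3,5) that] assms(5)
    by (simp add: ennreal_mult_cancel_left)
  then show ?thesis
    using samuel_filtration_eq_iff[OF filtration_twist[OF assms(3,5)] assms(4)] assms(5)
    by (auto simp: projectively_equivalent_def)
qed

end
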